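(* Let $G$ be a compact Hausdorff topological group, and let $X$ be a distributive binary $G$-space (with $X$ Hausdorff). Then the orbit space $X|G$ is Hausdorff.
   Context: A binary action of a topological group $G$ on a topological space $X$ is a continuous map $\alpha : G\times X^2\to X$, written $g(x,x')=\alpha(g,x,x')$, such that $gh(x,x')=g(x,h(x,x'))$ and $e(x,x')=x'$ for all $g,h\in G$, $x,x'\in X$, where $e$ is the identity of $G$ and $gh(x,x')$ means $(gh)(x,x')$. A space $X$ with a fixed binary action of $G$ is called a binary $G$-space. A binary $G$-space is distributive if $g(h(x,x'),h(x,x''))=h(x,g(x',x''))$ for all $x,x',x''\in X$ and $g,h\in G$. A subset $A\subset X$ is bi-invariant if $\{g(a,b) : g\in G,\ a,b\in A\}=A$. The orbit $[x]$ of $x\in X$ is the minimal bi-invariant subset of $X$ containing $x$. In a distributive binary $G$-space, $[x]=G(x,x)=\{g(x,x): g\in G\}$, and the orbits partition $X$. The orbit space $X|G$ is the set of orbits with the quotient topology induced by the map $X\to X|G$ taking each point to its orbit. *)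

theory Defs
  imports "HOL-Analysis.Analysis" "HOL-Algebra.Group"
begin

definition topological_group :: "('g, 'm) monoid_scheme \<Rightarrow> 'g topology \<Rightarrow> bool" where
  "topological_group G T \<longleftrightarrow>
     group G \<and> topspace T = carrier G \<and>
     continuous_map (prod_topology T T) T (\<lambda>(g, h). g \<otimes>\<^bsub>G\<^esub> h) \<and>
     continuous_map T T (\<lambda>g. inv\<^bsub>G\<^esub> g)"

text \<open>\<open>\<alpha> g x x'\<close> is written \<open>g(x, x')\<close> in the literature. Only its values for
  \<open>g \<in> carrier G\<close> and \<open>x, x' \<in> topspace X\<close> matter.\<close>

definition binary_G_space ::
    "('g, 'm) monoid_scheme \<Rightarrow> 'g topology \<Rightarrow> 'x topology \<Rightarrow> ('g \<Rightarrow> 'x \<Rightarrow> 'x \<Rightarrow> 'x) \<Rightarrow> bool" where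
  "binary_G_space G T X \<alpha> \<longleftrightarrow>
     topological_group G T \<and>
     continuous_map (prod_topology T (prod_topology X X)) X (\<lambda>(g, x, x'). \<alpha> g x x') \<and>
     (\<forall>g \<in> carrier G. \<forall>h \<in> carrier G. \<forall>x \<in> topspace X. \<forall>x' \<in> topspace X.
        \<alpha> (g \<otimes>\<^bsub>G\<^esub> h) x x' = \<alpha> g x (\<alpha> h x x')) \<and>
     (\<forall>x \<in> topspace X. \<forall>x' \<in> topspace X. \<alpha> \<one>\<^bsub>G\<^esub> x x' = x')"

definition distributive_binary_G_space ::
    "('g, 'm) monoid_scheme \<Rightarrow> 'g topology \<Rightarrow> 'x topology \<Rightarrow> ('g \<Rightarrow> 'x \<Rightarrow> 'x \<Rightarrow> 'x) \<Rightarrow> bool" where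
  "distributive_binary_G_space G T X \<alpha> \<longleftrightarrow>
     binary_G_space G T X \<alpha> \<and>
     (\<forall>g \<in> carrier G. \<forall>h \<in> carrier G.
        \<forall>x \<in> topspace X. \<forall>x' \<in> topspace X. \<forall>x'' \<in> topspace X.
          \<alpha> g (\<alpha> h x x') (\<alpha> h x x'') = \<alpha> h x (\<alpha> g x' x''))"

definition bi_invariant ::
    "('g, 'm) monoid_scheme \<Rightarrow> 'x topology \<Rightarrow> ('g \<Rightarrow> 'x \<Rightarrow> 'x \<Rightarrow> 'x) \<Rightarrow> 'x set \<Rightarrow> bool" where
  "bi_invariant G X \<alpha> A \<longleftrightarrow>
     A \<subseteq> topspace X \<and> {\<alpha> g a b | g a b. g \<in> carrier G \<and> a \<in> A \<and> b \<in> A} = A"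

text \<open>The intersection below is itself bi-invariant, so it is the minimal bi-invariant set
  containing \<open>x\<close>; see \<open>bi_orbit_bi_invariant\<close> and \<open>bi_orbit_minimal\<close>.\<close>

definition bi_orbit ::
    "('g, 'm) monoid_scheme \<Rightarrow> 'x topology \<Rightarrow> ('g \<Rightarrow> 'x \<Rightarrow> 'x \<Rightarrow> 'x) \<Rightarrow> 'x \<Rightarrow> 'x set" where
  "bi_orbit G X \<alpha> x = \<Inter> {A. bi_invariant G X \<alpha> A \<and> x \<in> A}"

definition orbit_space ::
    "('g, 'm) monoid_scheme \<Rightarrow> 'x topology \<Rightarrow> ('g \<Rightarrow> 'x \<Rightarrow> 'x \<Rightarrow> 'x) \<Rightarrow> 'x set topology" where
  "orbit_space G X \<alpha> = topology (\<lambda>U.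
     U \<subseteq> bi_orbit G X \<alpha> ` topspace X \<and>
     openin X {x \<in> topspace X. bi_orbit G X \<alpha> x \<in> U})"

lemma bi_invariant_topspace:
  assumes "binary_G_space G T X \<alpha>"
  shows "bi_invariant G X \<alpha> (topspace X)"
proof -
  have G: "group G" and T: "topspace T = carrier G"
    using assms by (auto simp: binary_G_space_def topological_group_def)
  have cm: "continuous_map (prod_topology T (prod_topology X X)) X (\<lambda>(g, x, x'). \<alpha> g x x')"
    using assms by (simp add: binary_G_space_def)
  have closed: "\<alpha> g a b \<in> topspace X"
    if "g \<in> carrier G" "a \<in> topspace X" "b \<in> topspace X" for g a b
    using continuous_map_image_subset_topspace[OF cm] that T by force
  have "\<exists>g a b. y = \<alpha> g a b \<and> g \<in> carrier G \<and> a \<in> topspace X \<and> b \<in> topspace X"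
    if "y \<in> topspace X" for y
  proof (intro exI conjI)
    show "y = \<alpha> \<one>\<^bsub>G\<^esub> y y" using assms that by (simp add: binary_G_space_def)
    show "\<one>\<^bsub>G\<^esub> \<in> carrier G" using G by (simp add: group.is_monoid)
  qed (use that in auto)
  with closed show ?thesis unfolding bi_invariant_def by blast
qed

lemma bi_orbit_self: "x \<in> bi_orbit G X \<alpha> x"
  by (simp add: bi_orbit_def)

lemma bi_orbit_minimal:
  assumes "bi_invariant G X \<alpha> A" "x \<in> A"
  shows "bi_orbit G X \<alpha> x \<subseteq> A"
  using assms by (auto simp: bi_orbit_def)

lemma bi_orbit_bi_invariant:
  assumes "binary_G_space G T X \<alpha>" "x \<in> topspace X"
  shows "bi_invariant G X \<alpha> (bi_orbit G X \<alpha> x)"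
proof -
  let ?O = "bi_orbit G X \<alpha> x"
  have G: "group G"
    using assms by (auto simp: binary_G_space_def topological_group_def)
  have sub: "?O \<subseteq> topspace X"
    by (rule bi_orbit_minimal[OF bi_invariant_topspace[OF assms(1)] assms(2)])
  have "\<alpha> g a b \<in> A"
    if "g \<in> carrier G" "a \<in> ?O" "b \<in> ?O" "bi_invariant G X \<alpha> A" "x \<in> A" for g a b A
  proof -
    have "a \<in> A" "b \<in> A" using bi_orbit_minimal[OF that(4,5)] that(2,3) by auto
    then show ?thesis using that(1,4) unfolding bi_invariant_def by blast
  qed
  then have 1: "\<alpha> g a b \<in> ?O" if "g \<in> carrier G" "a \<in> ?O" "b \<in> ?O" for g a b
    using that unfolding bi_orbit_def[of G X \<alpha> x] by blast
  have 2: "\<exists>g a b. y = \<alpha> g a b \<and> g \<in> carrier G \<and> a \<in> ?O \<and> b \<in> ?O" if "y \<in> ?O" for y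
  proof (intro exI conjI)
    show "y = \<alpha> \<one>\<^bsub>G\<^esub> y y" using assms that sub by (auto simp: binary_G_space_def)
    show "\<one>\<^bsub>G\<^esub> \<in> carrier G" using G by (simp add: group.is_monoid)
  qed (use that in auto)
  show ?thesis unfolding bi_invariant_def using sub 1 2 by blast
qed

lemma openin_orbit_space:
  "openin (orbit_space G X \<alpha>) U \<longleftrightarrow>
     U \<subseteq> bi_orbit G X \<alpha> ` topspace X \<and>
     openin X {x \<in> topspace X. bi_orbit G X \<alpha> x \<in> U}"
proof -
  let ?p = "bi_orbit G X \<alpha>"
  have "istopology (\<lambda>U. U \<subseteq> ?p ` topspace X \<and> openin X {x \<in> topspace X. ?p x \<in> U})"
    unfolding istopology_def
  proof (intro conjI allI impI; (elim conjE)?)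
    fix S U
    assume "openin X {x \<in> topspace X. ?p x \<in> S}" "openin X {x \<in> topspace X. ?p x \<in> U}"
    then have "openin X ({x \<in> topspace X. ?p x \<in> S} \<inter> {x \<in> topspace X. ?p x \<in> U})"
      by (rule openin_Int)
    moreover have "{x \<in> topspace X. ?p x \<in> S} \<inter> {x \<in> topspace X. ?p x \<in> U} =
        {x \<in> topspace X. ?p x \<in> S \<inter> U}" by auto
    ultimately show "openin X {x \<in> topspace X. ?p x \<in> S \<inter> U}" by simp
  next
    fix \<K>
    assume "\<forall>K\<in>\<K>. K \<subseteq> ?p ` topspace X \<and> openin X {x \<in> topspace X. ?p x \<in> K}"
    then have "openin X (\<Union>K\<in>\<K>. {x \<in> topspace X. ?p x \<in> K})" by blast
    moreover have "(\<Union>K\<in>\<K>. {x \<in> topspace X. ?p x \<in> K}) = {x \<in> topspace X. ?p x \<in> \<Union>\<K>}"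
      by auto
    ultimately show "openin X {x \<in> topspace X. ?p x \<in> \<Union>\<K>}" by simp
  qed blast+
  then show ?thesis by (simp add: orbit_space_def)
qed

lemma topspace_orbit_space:
  "topspace (orbit_space G X \<alpha>) = bi_orbit G X \<alpha> ` topspace X"
proof
  show "topspace (orbit_space G X \<alpha>) \<subseteq> bi_orbit G X \<alpha> ` topspace X"
    using openin_topspace[of "orbit_space G X \<alpha>"] unfolding openin_orbit_space by blast
  have "{x \<in> topspace X. bi_orbit G X \<alpha> x \<in> bi_orbit G X \<alpha> ` topspace X} = topspace X" by auto
  then have "openin (orbit_space G X \<alpha>) (bi_orbit G X \<alpha> ` topspace X)"
    by (simp add: openin_orbit_space)
  then show "bi_orbit G X \<alpha> ` topspace X \<subseteq> topspace (orbit_space G X \<alpha>)"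
    by (rule openin_subset)
qed

lemma quotient_map_bi_orbit: "quotient_map X (orbit_space G X \<alpha>) (bi_orbit G X \<alpha>)"
  by (auto simp: quotient_map_def topspace_orbit_space openin_orbit_space)

end

theory Submission
  imports Defs
begin

text \<open>In a distributive binary \<open>G\<close>-space the orbit of \<open>x\<close> is \<open>G(x, x)\<close>, so it is a compact
  continuous image of \<open>G\<close>, and distinct orbits are disjoint. Disjoint compact orbits have disjoint
  open neighbourhoods \<open>U\<close> and \<open>V\<close> in \<open>X\<close>. The set of orbits contained in an open set is open in
  \<open>X|G\<close>, because the projection \<open>G \<times> X \<rightarrow> X\<close> along the compact factor \<open>G\<close> is closed; so the orbits
  inside \<open>U\<close> and those inside \<open>V\<close> separate the two given points.\<close>

lemma binary_G_space_closed:
  assumes "binary_G_space G T X \<alpha>" "g \<in> carrier G" "x \<in> topspace X" "y \<in> topspace X"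
  shows "\<alpha> g x y \<in> topspace X"
  using bi_invariant_topspace[OF assms(1)] assms(2-) unfolding bi_invariant_def by blast

lemma binary_G_space_group:
  assumes "binary_G_space G T X \<alpha>"
  shows "group G" "topspace T = carrier G"
  using assms by (auto simp: binary_G_space_def topological_group_def)

lemma bi_orbit_eq_diagonal:
  assumes D: "distributive_binary_G_space G T X \<alpha>" and x: "x \<in> topspace X"
  shows "bi_orbit G X \<alpha> x = (\<lambda>g. \<alpha> g x x) ` carrier G"
proof
  let ?O = "(\<lambda>g. \<alpha> g x x) ` carrier G"
  have B: "binary_G_space G T X \<alpha>"
    using D by (simp add: distributive_binary_G_space_def)
  interpret group G by (rule binary_G_space_group[OF B])
  note closed = binary_G_space_closed[OF B]
  have mult: "\<alpha> (g \<otimes>\<^bsub>G\<^esub> h) a b = \<alpha> g a (\<alpha> h a b)"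
    if "g \<in> carrier G" "h \<in> carrier G" "a \<in> topspace X" "b \<in> topspace X" for g h a b
    using B that by (simp add: binary_G_space_def)
  have one: "\<alpha> \<one>\<^bsub>G\<^esub> a b = b" if "a \<in> topspace X" "b \<in> topspace X" for a b
    using B that by (simp add: binary_G_space_def)
  have "\<alpha> g (\<alpha> h x x) (\<alpha> k x x) \<in> ?O"
    if g: "g \<in> carrier G" and h: "h \<in> carrier G" and k: "k \<in> carrier G" for g h k
  proof
    let ?l = "inv\<^bsub>G\<^esub> h \<otimes>\<^bsub>G\<^esub> k"
    have l: "?l \<in> carrier G" using h k by simp
    have "h \<otimes>\<^bsub>G\<^esub> ?l = k" using h k by (simp add: m_assoc[symmetric])
    then have "\<alpha> k x x = \<alpha> h x (\<alpha> ?l x x)"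
      using mult[OF h l x x] by simp
    then have "\<alpha> g (\<alpha> h x x) (\<alpha> k x x) = \<alpha> h x (\<alpha> g x (\<alpha> ?l x x))"
      using D g h x closed[OF l x x] by (simp add: distributive_binary_G_space_def)
    also have "\<dots> = \<alpha> (h \<otimes>\<^bsub>G\<^esub> (g \<otimes>\<^bsub>G\<^esub> ?l)) x x"
      using mult g h l x closed by simp
    finally show "\<alpha> g (\<alpha> h x x) (\<alpha> k x x) = \<alpha> (h \<otimes>\<^bsub>G\<^esub> (g \<otimes>\<^bsub>G\<^esub> ?l)) x x" .
    show "h \<otimes>\<^bsub>G\<^esub> (g \<otimes>\<^bsub>G\<^esub> ?l) \<in> carrier G" using g h l by simp
  qed
  moreover have "?O \<subseteq> topspace X" using closed x by auto
  moreover have "y = \<alpha> \<one>\<^bsub>G\<^esub> y y" if "y \<in> ?O" for y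
    using that one closed x by auto
  ultimately have "bi_invariant G X \<alpha> ?O"
    unfolding bi_invariant_def using one_closed by (safe, blast, blast)
  moreover have "x \<in> ?O" using one[OF x x] one_closed by force
  ultimately show "bi_orbit G X \<alpha> x \<subseteq> ?O" by (rule bi_orbit_minimal)
  show "?O \<subseteq> bi_orbit G X \<alpha> x"
    using bi_orbit_bi_invariant[OF B x] bi_orbit_self[of x G X \<alpha>]
    unfolding bi_invariant_def by blast
qed

lemma bi_orbit_eq:
  assumes D: "distributive_binary_G_space G T X \<alpha>" and x: "x \<in> topspace X"
    and y: "y \<in> bi_orbit G X \<alpha> x"
  shows "bi_orbit G X \<alpha> y = bi_orbit G X \<alpha> x"
proof -
  have B: "binary_G_space G T X \<alpha>"
    using D by (simp add: distributive_binary_G_space_def)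
  interpret group G by (rule binary_G_space_group[OF B])
  obtain g where g: "g \<in> carrier G" and yg: "y = \<alpha> g x x"
    using y bi_orbit_eq_diagonal[OF D x] by auto
  have yX: "y \<in> topspace X" using binary_G_space_closed[OF B g x x] yg by simp
  have act: "\<alpha> h y y = \<alpha> (g \<otimes>\<^bsub>G\<^esub> h) x x" if "h \<in> carrier G" for h
    using D B g that x unfolding yg
    by (simp add: distributive_binary_G_space_def binary_G_space_def)
  have "h \<in> (\<lambda>k. g \<otimes>\<^bsub>G\<^esub> k) ` carrier G" if "h \<in> carrier G" for h
    using that g by (intro image_eqI[of _ _ "inv\<^bsub>G\<^esub> g \<otimes>\<^bsub>G\<^esub> h"]) (simp_all add: m_assoc[symmetric])
  then have "(\<lambda>h. g \<otimes>\<^bsub>G\<^esub> h) ` carrier G = carrier G"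
    using g by auto
  then have "(\<lambda>h. \<alpha> h x x) ` carrier G = (\<lambda>h. \<alpha> (g \<otimes>\<^bsub>G\<^esub> h) x x) ` carrier G"
    using image_image[of "\<lambda>h. \<alpha> h x x" "\<lambda>h. g \<otimes>\<^bsub>G\<^esub> h" "carrier G"] by simp
  then show ?thesis
    using act by (simp add: bi_orbit_eq_diagonal[OF D x] bi_orbit_eq_diagonal[OF D yX])
qed

lemma continuous_map_diagonal_action:
  assumes "binary_G_space G T X \<alpha>"
  shows "continuous_map (prod_topology T X) X (\<lambda>(g, x). \<alpha> g x x)"
proof -
  have "continuous_map (prod_topology T X) (prod_topology T (prod_topology X X))
          (\<lambda>p. (fst p, snd p, snd p))"
    by (intro continuous_map_pairedI continuous_map_fst continuous_map_snd)
  moreover have "continuous_map (prod_topology T (prod_topology X X)) X (\<lambda>(g, x, x'). \<alpha> g x x')"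
    using assms by (simp add: binary_G_space_def)
  ultimately have "continuous_map (prod_topology T X) X
      ((\<lambda>(g, x, x'). \<alpha> g x x') \<circ> (\<lambda>p. (fst p, snd p, snd p)))"
    by (rule continuous_map_compose)
  then show ?thesis by (simp add: o_def case_prod_beta')
qed

lemma compactin_bi_orbit:
  assumes D: "distributive_binary_G_space G T X \<alpha>" and "compact_space T" and x: "x \<in> topspace X"
  shows "compactin X (bi_orbit G X \<alpha> x)"
proof -
  have B: "binary_G_space G T X \<alpha>"
    using D by (simp add: distributive_binary_G_space_def)
  have "continuous_map T (prod_topology T X) (\<lambda>g. (g, x))"
    using x by (intro continuous_map_pairedI) auto
  from continuous_map_compose[OF this continuous_map_diagonal_action[OF B]]
  have "continuous_map T X (\<lambda>g. \<alpha> g x x)"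
    by (simp add: o_def)
  with \<open>compact_space T\<close> show ?thesis
    unfolding bi_orbit_eq_diagonal[OF D x] binary_G_space_group(2)[OF B, symmetric]
    by (auto simp: compact_space_def intro: image_compactin)
qed

lemma openin_orbit_space_subset:
  assumes D: "distributive_binary_G_space G T X \<alpha>" and "compact_space T" and U: "openin X U"
  shows "openin (orbit_space G X \<alpha>) {A \<in> bi_orbit G X \<alpha> ` topspace X. A \<subseteq> U}"
proof -
  have B: "binary_G_space G T X \<alpha>"
    using D by (simp add: distributive_binary_G_space_def)
  let ?C = "{p \<in> topspace (prod_topology T X). (\<lambda>(g, x). \<alpha> g x x) p \<in> topspace X - U}"
  have "closedin (prod_topology T X) ?C"
    using continuous_map_diagonal_action[OF B] U
    by (intro closedin_continuous_map_preimage) auto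
  then have "closedin X (snd ` ?C)"
    using closed_map_snd[OF \<open>compact_space T\<close>] by (auto simp: closed_map_def)
  then have "openin X (topspace X - snd ` ?C)" by blast
  also have "topspace X - snd ` ?C = {x \<in> topspace X. bi_orbit G X \<alpha> x \<subseteq> U}"
    using binary_G_space_closed[OF B]
    by (force simp: bi_orbit_eq_diagonal[OF D] binary_G_space_group(2)[OF B])
  finally have "openin X {x \<in> topspace X. bi_orbit G X \<alpha> x \<subseteq> U}" .
  moreover have "{x \<in> topspace X. bi_orbit G X \<alpha> x \<in> {A \<in> bi_orbit G X \<alpha> ` topspace X. A \<subseteq> U}}
      = {x \<in> topspace X. bi_orbit G X \<alpha> x \<subseteq> U}" by auto
  ultimately show ?thesis by (simp add: openin_orbit_space)
qed

theorem theorem5: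
  fixes G :: "('g, 'm) monoid_scheme"
    and T :: "'g topology"
    and X :: "'x topology"
    and \<alpha> :: "'g \<Rightarrow> 'x \<Rightarrow> 'x \<Rightarrow> 'x"
  assumes "topological_group G T"
    and "compact_space T"
    and "Hausdorff_space T"
    and "distributive_binary_G_space G T X \<alpha>"
    and "Hausdorff_space X"
  shows "Hausdorff_space (orbit_space G X \<alpha>)"
  unfolding Hausdorff_space_def topspace_orbit_space
proof (intro allI impI; elim conjE imageE)
  fix P Q x y
  assume x: "x \<in> topspace X" and y: "y \<in> topspace X"
    and P: "P = bi_orbit G X \<alpha> x" and Q: "Q = bi_orbit G X \<alpha> y" and "P \<noteq> Q"
  note D = assms(4) and K = assms(2)
  have "disjnt P Q"
    using bi_orbit_eq[OF D x] bi_orbit_eq[OF D y] \<open>P \<noteq> Q\<close>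
    unfolding P Q disjnt_iff by metis
  then obtain U V where UV: "openin X U" "openin X V" "P \<subseteq> U" "Q \<subseteq> V" "disjnt U V"
    using assms(5) compactin_bi_orbit[OF D K x] compactin_bi_orbit[OF D K y]
    unfolding P Q Hausdorff_space_compact_sets by meson
  let ?W = "\<lambda>U. {A \<in> bi_orbit G X \<alpha> ` topspace X. A \<subseteq> U}"
  have "disjnt (?W U) (?W V)"
    using UV(5) bi_orbit_self[of _ G X \<alpha>] unfolding disjnt_iff by blast
  moreover have "P \<in> ?W U" "Q \<in> ?W V" using UV x y P Q by auto
  ultimately show "\<exists>U V. openin (orbit_space G X \<alpha>) U \<and> openin (orbit_space G X \<alpha>) V \<and>
      P \<in> U \<and> Q \<in> V \<and> disjnt U V"
    using openin_orbit_space_subset[OF D K] UV(1,2) by meson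
qed

end
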